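(* Let $m,n,p,q$ be positive integers and let $N\in\mathcal{M}_{mp\times nq}$ be a real matrix. Let $$\Psi:=I_n\otimes W_{[m,q]}\otimes I_p .$$ Then there exist $A\in\mathcal{M}_{m\times n}$ and $B\in\mathcal{M}_{p\times q}$ such that $N=A\otimes B$ if and only if the vector $\Psi^{\mathrm T}V(N)\in\mathbb{R}^{mnpq}$ is decomposable with respect to $mn\times pq$, i.e. there exist $y\in\mathbb{R}^{mn}$ and $z\in\mathbb{R}^{pq}$ such that $\Psi^{\mathrm T}V(N)=y\otimes z$.
   Context: $\mathcal{M}_{r\times s}$ is the set of real $r\times s$ matrices, $\otimes$ is the Kronecker product, and $V(N)=V_c(N)$ is the column stacking form of $N$ (the columns of $N$ stacked on top of each other, first column first). The swap matrix is $W_{[m,q]}:=[I_q\otimes\delta_m^1,\ I_q\otimes\delta_m^2,\ \dots,\ I_q\otimes\delta_m^m]\in\mathcal{M}_{mq\times mq}$, where $\delta_m^i$ is the $i$-th column of $I_m$; equivalently, it is the matrix with $W_{[m,q]}(x\otimes y)=y\otimes x$ for all $x\in\mathbb{R}^m$, $y\in\mathbb{R}^q$. *)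

theory Defs
  imports "Jordan_Normal_Form.Matrix"
begin

text \<open>All rows, columns and vector entries are indexed from 0, as in the underlying matrix library.\<close>

definition kronecker_mat :: "'a :: semiring_1 mat \<Rightarrow> 'a mat \<Rightarrow> 'a mat" (infixl "\<otimes>\<^sub>m" 70) where
  "A \<otimes>\<^sub>m B = mat (dim_row A * dim_row B) (dim_col A * dim_col B)
     (\<lambda>(i, j). A $$ (i div dim_row B, j div dim_col B) * B $$ (i mod dim_row B, j mod dim_col B))"

text \<open>The Kronecker product of two column vectors, as a vector rather than a one-column matrix.\<close>

definition kronecker_vec :: "'a :: semiring_1 vec \<Rightarrow> 'a vec \<Rightarrow> 'a vec" (infixl "\<otimes>\<^sub>v" 70) where
  "x \<otimes>\<^sub>v y = vec (dim_vec x * dim_vec y) (\<lambda>i. x $ (i div dim_vec y) * y $ (i mod dim_vec y))"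

definition col_stack :: "'a mat \<Rightarrow> 'a vec" where
  "col_stack N = vec_of_list (concat (map list_of_vec (cols N)))"

text \<open>The block row \<open>[I\<^sub>q \<otimes> \<delta>\<^sub>m\<^sup>1, \<dots>, I\<^sub>q \<otimes> \<delta>\<^sub>m\<^sup>m]\<close>, obtained by listing the columns of its
  blocks from left to right; \<open>mat_of_cols m [unit_vec m i]\<close> is the unit vector as an
  \<open>m \<times> 1\<close> matrix.\<close>

definition swap_mat :: "nat \<Rightarrow> nat \<Rightarrow> 'a :: semiring_1 mat" where
  "swap_mat m q = mat_of_cols (m * q)
     (concat (map (\<lambda>i. cols (1\<^sub>m q \<otimes>\<^sub>m mat_of_cols m [unit_vec m i])) [0..<m]))"

definition decomposable_vec :: "nat \<Rightarrow> nat \<Rightarrow> 'a :: semiring_1 vec \<Rightarrow> bool" where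
  "decomposable_vec r s x \<longleftrightarrow> (\<exists>y \<in> carrier_vec r. \<exists>z \<in> carrier_vec s. x = y \<otimes>\<^sub>v z)"

lemma kronecker_mat_carrier:
  "A \<in> carrier_mat m n \<Longrightarrow> B \<in> carrier_mat p q \<Longrightarrow> A \<otimes>\<^sub>m B \<in> carrier_mat (m * p) (n * q)"
  by (auto simp: kronecker_mat_def)

lemma kronecker_vec_carrier:
  "x \<in> carrier_vec m \<Longrightarrow> y \<in> carrier_vec q \<Longrightarrow> x \<otimes>\<^sub>v y \<in> carrier_vec (m * q)"
  by (auto simp: kronecker_vec_def)

lemma concat_equal_length:
  assumes "\<And>i. i < n \<Longrightarrow> length (f i) = k"
  shows "length (concat (map f [0..<n])) = n * k"
    and "j < n * k \<Longrightarrow> concat (map f [0..<n]) ! j = f (j div k) ! (j mod k)"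
proof -
  have "length (concat (map f [0..<n])) = n * k \<and>
    (\<forall>j < n * k. concat (map f [0..<n]) ! j = f (j div k) ! (j mod k))"
    using assms
  proof (induction n)
    case (Suc n)
    have len: "length (concat (map f [0..<n])) = n * k"
      and nth: "\<And>j. j < n * k \<Longrightarrow> concat (map f [0..<n]) ! j = f (j div k) ! (j mod k)"
      using Suc by auto
    have "concat (map f [0..<Suc n]) ! j = f (j div k) ! (j mod k)" if j: "j < Suc n * k" for j
    proof (cases "j < n * k")
      case True
      then show ?thesis using len nth[OF True] by (simp add: nth_append)
    next
      case False
      then have "j div k = n" using j by (intro div_nat_eqI) (auto simp: mult.commute)
      moreover have "j mod k = j - n * k" using calculation by (metis minus_div_mult_eq_mod)
      ultimately show ?thesis using len False by (simp add: nth_append)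
    qed
    then show ?case using len Suc.prems by simp
  qed simp
  then show "length (concat (map f [0..<n])) = n * k"
    and "j < n * k \<Longrightarrow> concat (map f [0..<n]) ! j = f (j div k) ! (j mod k)" by auto
qed

lemma col_stack_dim [simp]: "dim_vec (col_stack N) = dim_row N * dim_col N"
  and col_stack_index:
    "k < dim_row N * dim_col N \<Longrightarrow> col_stack N $ k = N $$ (k mod dim_row N, k div dim_row N)"
proof -
  let ?f = "\<lambda>j. list_of_vec (col N j)"
  have eq: "col_stack N = vec_of_list (concat (map ?f [0..<dim_col N]))"
    by (simp add: col_stack_def cols_def comp_def)
  note cl = concat_equal_length[of "dim_col N" ?f "dim_row N"]
  show "dim_vec (col_stack N) = dim_row N * dim_col N"
    using cl(1) by (simp add: eq mult.commute)
  assume k: "k < dim_row N * dim_col N"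
  then have "0 < dim_row N" by (cases "dim_row N") auto
  then have "k mod dim_row N < dim_row N" "k div dim_row N < dim_col N"
    using k by (auto simp: less_mult_imp_div_less mult.commute)
  then show "col_stack N $ k = N $$ (k mod dim_row N, k div dim_row N)"
    using cl(2)[of k] k by (simp add: eq mult.commute list_of_vec_index vec_of_list_index)
qed

lemma swap_mat_carrier [simp]: "(swap_mat m q :: 'a :: semiring_1 mat) \<in> carrier_mat (m * q) (m * q)"
  and swap_mat_index:
    "r < m * q \<Longrightarrow> c < m * q \<Longrightarrow>
      swap_mat m q $$ (r, c) = (if r div m = c mod q \<and> r mod m = c div q then 1 else 0 :: 'a)"
proof -
  let ?f = "\<lambda>i. cols (1\<^sub>m q \<otimes>\<^sub>m mat_of_cols m [unit_vec m i :: 'a vec])"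
  have len: "length (?f i) = q" for i by (simp add: kronecker_mat_def)
  define cs where "cs = concat (map ?f [0..<m])"
  have cs_len: "length cs = m * q"
    unfolding cs_def by (rule concat_equal_length(1)) (rule len)
  have swap: "swap_mat m q = mat_of_cols (m * q) cs"
    unfolding swap_mat_def cs_def ..
  show "(swap_mat m q :: 'a mat) \<in> carrier_mat (m * q) (m * q)"
    unfolding swap using mat_of_cols_carrier(1)[of "m * q" cs] by (simp only: cs_len)
  assume r: "r < m * q" and c: "c < m * q"
  then have pos: "0 < m" "0 < q" by (auto intro: gr0I)
  have rc: "r div m < q" "r mod m < m" "c div q < m" "c mod q < q" "r < q * m"
    using r c pos by (auto simp: less_mult_imp_div_less mult.commute)
  have cs_nth: "cs ! c = ?f (c div q) ! (c mod q)"
    unfolding cs_def by (rule concat_equal_length(2)[OF len c])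
  have "swap_mat m q $$ (r, c) = cs ! c $ r"
    unfolding swap using r c by (intro mat_of_cols_index) (simp_all only: cs_len)
  also have "\<dots> = (if r div m = c mod q \<and> r mod m = c div q then 1 else 0 :: 'a)"
    unfolding cs_nth using rc by (simp add: kronecker_mat_def mat_of_cols_index)
  finally show "swap_mat m q $$ (r, c) = (if r div m = c mod q \<and> r mod m = c div q then 1 else 0 :: 'a)" .
qed

lemma swap_mat_kronecker_vec:
  fixes x y :: "'a :: comm_semiring_1 vec"
  assumes x: "x \<in> carrier_vec m" and y: "y \<in> carrier_vec q"
  shows "swap_mat m q *\<^sub>v (x \<otimes>\<^sub>v y) = y \<otimes>\<^sub>v x"
proof (rule eq_vecI)
  have sw: "(swap_mat m q :: 'a mat) \<in> carrier_mat (m * q) (m * q)" by simp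
  show "dim_vec (swap_mat m q *\<^sub>v (x \<otimes>\<^sub>v y)) = dim_vec (y \<otimes>\<^sub>v x)"
    using x y carrier_matD[OF sw] by (simp add: kronecker_vec_def)
  fix r assume "r < dim_vec (y \<otimes>\<^sub>v x)"
  then have r: "r < m * q" using x y by (simp add: kronecker_vec_def mult.commute)
  then have pos: "0 < m" "0 < q" by (auto intro: gr0I)
  define c where "c = (r mod m) * q + r div m"
  have rd: "r div m < q" using r by (simp add: less_mult_imp_div_less mult.commute)
  have rm: "r mod m < m" using pos by simp
  have cd: "c div q = r mod m" "c mod q = r div m" using rd pos by (auto simp: c_def)
  have "c < Suc (r mod m) * q" using rd by (simp add: c_def)
  also have "\<dots> \<le> m * q" using rm by (intro mult_right_mono) auto
  finally have c: "c < m * q" .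
  have "(swap_mat m q *\<^sub>v (x \<otimes>\<^sub>v y)) $ r
      = (\<Sum>k<m * q. (if k = c then (x \<otimes>\<^sub>v y) $ k else 0))"
  proof -
    have "swap_mat m q $$ (r, k) = (if k = c then 1 else 0 :: 'a)" if "k < m * q" for k
    proof -
      have "(r div m = k mod q \<and> r mod m = k div q) \<longleftrightarrow> k = c"
        using cd by (metis c_def div_mult_mod_eq)
      then show ?thesis using swap_mat_index[OF r that] by simp
    qed
    then show ?thesis
      using r x y carrier_matD[OF sw]
      by (auto simp: scalar_prod_def lessThan_atLeast0
          carrier_vecD[OF kronecker_vec_carrier[OF x y]] if_distrib[of "\<lambda>t. t * _"] cong: if_cong)
  qed
  also have "\<dots> = (x \<otimes>\<^sub>v y) $ c" using c by simp
  also have "\<dots> = (y \<otimes>\<^sub>v x) $ r"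
    using x y r c cd by (simp add: kronecker_vec_def mult.commute)
  finally show "(swap_mat m q *\<^sub>v (x \<otimes>\<^sub>v y)) $ r = (y \<otimes>\<^sub>v x) $ r" .
qed

end

theory Submission
  imports Defs
begin

text \<open>Applying \<open>\<Psi>\<^sup>T\<close> only permutes the entries of V(N). Write a row of
  N as \<open>a * p + e\<close> and a column as \<open>b * q + d\<close>: (a, b) names a block of
  size p by q, and (e, d) a position inside it. V(N) lists the entries by the digits b, d, a, e,
  most significant first; the swap matrix exchanges the middle two, giving b, a, d, e. Now (b, a) is
  the column stacking index of an m by n matrix and (d, e) that of a p by q matrix. So the entrywise
  form of N = A \<otimes> B, namely N(ap + e, bq + d) = A(a, b) B(e, d), is also the entrywise form
  of \<open>\<Psi>\<^sup>T\<close> V(N) = V(A) \<otimes> V(B). Every vector of the right length is V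
  of some matrix, which gives the converse. \<open>swap_block_index\<close> computes the entries of
  \<Psi>, and \<open>swap_block_col_stack_index\<close> deduces the rearrangement of N.\<close>

lemma kronecker_mat_index:
  assumes "A \<in> carrier_mat m n" "B \<in> carrier_mat p q" "i < m * p" "j < n * q"
  shows "(A \<otimes>\<^sub>m B) $$ (i, j) = A $$ (i div p, j div q) * B $$ (i mod p, j mod q)"
  using assms by (auto simp: kronecker_mat_def)

lemma mixed_radix_less:
  fixes a d m n :: nat
  assumes "a < m" "d < n"
  shows "a * n + d < m * n"
proof -
  have "a * n + d < Suc a * n" using assms by simp
  also have "\<dots> \<le> m * n" using assms by (intro mult_right_mono) auto
  finally show ?thesis .
qed

text \<open>In mixed radix digits, \<open>\<Psi>\<close> is the permutation matrix that sends the index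
  \<open>(b, a, d, e)\<close> to \<open>(b, d, a, e)\<close>.\<close>

lemma swap_block_index:
  fixes m n p q :: nat
  defines "\<Psi> \<equiv> 1\<^sub>m n \<otimes>\<^sub>m swap_mat m q \<otimes>\<^sub>m 1\<^sub>m p :: 'a :: semiring_1 mat"
  assumes "a < m" "b < n" "d < q" "e < p" and l: "l < n * (m * q) * p"
  shows "\<Psi> $$ (l, (b * (m * q) + (a * q + d)) * p + e) =
    (if l = (b * (m * q) + (d * m + a)) * p + e then 1 else 0)"
proof -
  define k where "k = (b * (m * q) + (a * q + d)) * p + e"
  have c: "a * q + d < m * q" using assms by (intro mixed_radix_less)
  have r: "d * m + a < m * q" using assms mixed_radix_less[of d q a m] by (simp add: mult.commute)
  have bc: "b * (m * q) + (a * q + d) < n * (m * q)"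
    using \<open>b < n\<close> c by (rule mixed_radix_less)
  have k: "k < n * (m * q) * p"
    unfolding k_def using bc \<open>e < p\<close> by (rule mixed_radix_less)
  have kd: "k div p = b * (m * q) + (a * q + d)" "k mod p = e"
    using \<open>e < p\<close> by (auto simp: k_def)
  have kdd: "k div p div (m * q) = b" "k div p mod (m * q) = a * q + d"
    unfolding kd using c \<open>a < m\<close> \<open>d < q\<close> by auto
  have lp: "l div p < n * (m * q)" "l mod p < p"
    using l \<open>e < p\<close> by (auto simp: less_mult_imp_div_less)
  have lpp: "l div p div (m * q) < n" "l div p mod (m * q) < m * q"
    using lp \<open>a < m\<close> \<open>d < q\<close> by (auto simp: less_mult_imp_div_less)
  \<comment> \<open>Peeling off Kronecker factors from the right strips digits from the least
    significant end: first modulo p, then modulo \<open>m * q\<close>.\<close>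
  have "\<Psi> $$ (l, k) = (1\<^sub>m n \<otimes>\<^sub>m swap_mat m q) $$ (l div p, k div p) * 1\<^sub>m p $$ (l mod p, k mod p)"
    unfolding \<Psi>_def using l k
    by (intro kronecker_mat_index[of _ "n * (m * q)" "n * (m * q)"] kronecker_mat_carrier) auto
  also have "(1\<^sub>m n \<otimes>\<^sub>m swap_mat m q :: 'a mat) $$ (l div p, k div p) =
      1\<^sub>m n $$ (l div p div (m * q), b) * swap_mat m q $$ (l div p mod (m * q), a * q + d)"
    using kronecker_mat_index[of "1\<^sub>m n :: 'a mat" n n "swap_mat m q" "m * q" "m * q" "l div p" "k div p"]
      lp bc by (simp only: kdd) (simp add: kd)
  \<comment> \<open>The swap matrix takes the basis vector with digits (a, d) to the one with digits
    (d, a), whose position is \<open>d * m + a\<close>.\<close>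
  also have "swap_mat m q $$ (l div p mod (m * q), a * q + d) =
      (if l div p mod (m * q) = d * m + a then 1 else 0 :: 'a)"
  proof -
    have "(x div m = d \<and> x mod m = a) \<longleftrightarrow> x = d * m + a" for x
      using \<open>a < m\<close> by (auto simp: mult.commute)
    then show ?thesis using swap_mat_index[OF lpp(2) c] \<open>d < q\<close> by simp
  qed
  also have "1\<^sub>m n $$ (l div p div (m * q), b) * (if l div p mod (m * q) = d * m + a then 1 else 0 :: 'a)
      * 1\<^sub>m p $$ (l mod p, k mod p) =
      (if l div p div (m * q) = b \<and> l div p mod (m * q) = d * m + a \<and> l mod p = e then 1 else 0)"
    using lpp lp \<open>b < n\<close> \<open>e < p\<close> kd by auto
  also have "(l div p div (m * q) = b \<and> l div p mod (m * q) = d * m + a \<and> l mod p = e) \<longleftrightarrow>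
      l = (b * (m * q) + (d * m + a)) * p + e"
  proof
    assume "l div p div (m * q) = b \<and> l div p mod (m * q) = d * m + a \<and> l mod p = e"
    then show "l = (b * (m * q) + (d * m + a)) * p + e"
      by (metis div_mult_mod_eq)
  next
    assume "l = (b * (m * q) + (d * m + a)) * p + e"
    moreover from this have "l div p = b * (m * q) + (d * m + a)" using \<open>e < p\<close> by simp
    ultimately show "l div p div (m * q) = b \<and> l div p mod (m * q) = d * m + a \<and> l mod p = e"
      using r \<open>a < m\<close> \<open>d < q\<close> \<open>e < p\<close> by auto
  qed
  finally show ?thesis unfolding k_def .
qed

text \<open>The vector \<open>\<Psi>\<^sup>T V(N)\<close> is the stacking form of the rearrangement of \<open>N\<close> in which each
  \<open>p \<times> q\<close> block becomes a column; for \<open>N = A \<otimes> B\<close> this rearrangement has rank at most one.\<close>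

lemma swap_block_col_stack_index:
  fixes N :: "'a :: semiring_1 mat"
  assumes N: "N \<in> carrier_mat (m * p) (n * q)"
    and "a < m" "b < n" "d < q" "e < p"
  shows "((1\<^sub>m n \<otimes>\<^sub>m swap_mat m q \<otimes>\<^sub>m 1\<^sub>m p)\<^sup>T *\<^sub>v col_stack N) $ ((b * m + a) * (p * q) + (d * p + e))
    = N $$ (a * p + e, b * q + d)"
proof -
  let ?\<Psi> = "1\<^sub>m n \<otimes>\<^sub>m swap_mat m q \<otimes>\<^sub>m 1\<^sub>m p :: 'a mat"
  let ?D = "n * (m * q) * p"
  define k where "k = (b * (m * q) + (a * q + d)) * p + e"
  define l where "l = (b * (m * q) + (d * m + a)) * p + e"
  have \<Psi>: "?\<Psi> \<in> carrier_mat ?D ?D" by (intro kronecker_mat_carrier) auto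
  have k: "k < ?D"
    unfolding k_def using assms by (intro mixed_radix_less)
  have r: "d * m + a < m * q" using assms mixed_radix_less[of d q a m] by (simp add: mult.commute)
  have l: "l < ?D"
    unfolding l_def using assms r by (intro mixed_radix_less)
  have V: "dim_vec (col_stack N) = ?D" using N by simp
  \<comment> \<open>Entry k pairs column k of \<Psi> with V(N), and the only 1 of that column is in
    row l.\<close>
  have "(?\<Psi>\<^sup>T *\<^sub>v col_stack N) $ k = (\<Sum>i<?D. ?\<Psi> $$ (i, k) * col_stack N $ i)"
    using \<Psi> k V by (simp add: scalar_prod_def lessThan_atLeast0)
  also have "\<dots> = (\<Sum>i<?D. if i = l then col_stack N $ i else 0)"
    unfolding k_def l_def using assms by (intro sum.cong) (auto simp: swap_block_index)
  also have "\<dots> = col_stack N $ l" using l by simp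
  also have "\<dots> = N $$ (l mod (m * p), l div (m * p))"
    using N l by (subst col_stack_index) (auto simp: algebra_simps)
  \<comment> \<open>Regrouped by \<open>m * p\<close>, the height of a column of N, l shows the
    column as quotient and the row as remainder.\<close>
  also have "l = (b * q + d) * (m * p) + (a * p + e)" by (simp add: l_def algebra_simps)
  also have "\<dots> mod (m * p) = a * p + e"
    using assms mixed_radix_less[of a m e p] by simp
  also have "((b * q + d) * (m * p) + (a * p + e)) div (m * p) = b * q + d"
    using assms mixed_radix_less[of a m e p] by simp
  \<comment> \<open>Regrouping by \<open>p * q\<close> splits k at the boundary between the two
    factors of a Kronecker product of vectors.\<close>
  also have "k = (b * m + a) * (p * q) + (d * p + e)" by (simp add: k_def algebra_simps)
  finally show ?thesis .
qed

theorem theoremV2: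
  fixes m n p q :: nat and N \<Psi> :: "real mat"
  assumes "0 < m" and "0 < n" and "0 < p" and "0 < q"
    and "N \<in> carrier_mat (m * p) (n * q)"
    and "\<Psi> = 1\<^sub>m n \<otimes>\<^sub>m swap_mat m q \<otimes>\<^sub>m 1\<^sub>m p"
  shows "(\<exists>A \<in> carrier_mat m n. \<exists>B \<in> carrier_mat p q. N = A \<otimes>\<^sub>m B) \<longleftrightarrow>
    decomposable_vec (m * n) (p * q) (\<Psi>\<^sup>T *\<^sub>v col_stack N)"
proof
  assume "\<exists>A \<in> carrier_mat m n. \<exists>B \<in> carrier_mat p q. N = A \<otimes>\<^sub>m B"
  then obtain A B where A: "A \<in> carrier_mat m n" and B: "B \<in> carrier_mat p q" and NAB: "N = A \<otimes>\<^sub>m B"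
    by blast
  have yz: "col_stack A \<in> carrier_vec (m * n)" "col_stack B \<in> carrier_vec (p * q)"
    using A B by (auto intro: carrier_vecI)
  have "\<Psi>\<^sup>T *\<^sub>v col_stack N = col_stack A \<otimes>\<^sub>v col_stack B"
  proof (rule eq_vecI)
    show "dim_vec (\<Psi>\<^sup>T *\<^sub>v col_stack N) = dim_vec (col_stack A \<otimes>\<^sub>v col_stack B)"
      using A B carrier_matD[OF swap_mat_carrier[of m q, where 'a = real]] assms
      by (simp add: kronecker_vec_def kronecker_mat_def)
  next
    fix k assume "k < dim_vec (col_stack A \<otimes>\<^sub>v col_stack B)"
    then have k: "k < m * n * (p * q)" using A B by (simp add: kronecker_vec_def)
    define i j where "i = k div (p * q)" and "j = k mod (p * q)"
    have i: "i < m * n" and j: "j < p * q"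
      using k assms by (auto simp: i_def j_def less_mult_imp_div_less)
    \<comment> \<open>In column stacking the row is the remainder, so i addresses entry (a, b) of A
      and j entry (e, d) of B.\<close>
    define a b d e where "a = i mod m" and "b = i div m" and "d = j div p" and "e = j mod p"
    have abde: "a < m" "b < n" "d < q" "e < p"
      using i j assms by (auto simp: a_def b_def d_def e_def less_mult_imp_div_less mult.commute)
    have k_eq: "k = (b * m + a) * (p * q) + (d * p + e)"
      unfolding a_def b_def d_def e_def i_def j_def by (simp only: div_mult_mod_eq)
    have "(\<Psi>\<^sup>T *\<^sub>v col_stack N) $ k = N $$ (a * p + e, b * q + d)"
      unfolding assms(6) k_eq using assms(5) abde by (rule swap_block_col_stack_index)
    also have "\<dots> = A $$ (a, b) * B $$ (e, d)"
      unfolding NAB using abde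
      by (subst kronecker_mat_index[OF A B]) (auto intro: mixed_radix_less)
    also have "\<dots> = col_stack A $ i * col_stack B $ j"
      using A B i j by (simp add: col_stack_index a_def b_def d_def e_def)
    also have "\<dots> = (col_stack A \<otimes>\<^sub>v col_stack B) $ k"
      using A B k by (simp add: kronecker_vec_def i_def j_def)
    finally show "(\<Psi>\<^sup>T *\<^sub>v col_stack N) $ k = (col_stack A \<otimes>\<^sub>v col_stack B) $ k" .
  qed
  with yz show "decomposable_vec (m * n) (p * q) (\<Psi>\<^sup>T *\<^sub>v col_stack N)"
    unfolding decomposable_vec_def by blast
next
  assume "decomposable_vec (m * n) (p * q) (\<Psi>\<^sup>T *\<^sub>v col_stack N)"
  then obtain y z where y: "y \<in> carrier_vec (m * n)" and z: "z \<in> carrier_vec (p * q)"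
    and eq: "\<Psi>\<^sup>T *\<^sub>v col_stack N = y \<otimes>\<^sub>v z"
    unfolding decomposable_vec_def by blast
  \<comment> \<open>Undoing the column stacking: A and B are chosen so that y = V(A) and z =
    V(B).\<close>
  define A where "A = mat m n (\<lambda>(a, b). y $ (b * m + a))"
  define B where "B = mat p q (\<lambda>(e, d). z $ (d * p + e))"
  have A: "A \<in> carrier_mat m n" and B: "B \<in> carrier_mat p q" by (auto simp: A_def B_def)
  have "N = A \<otimes>\<^sub>m B"
  proof (rule eq_matI)
    fix i j assume "i < dim_row (A \<otimes>\<^sub>m B)" "j < dim_col (A \<otimes>\<^sub>m B)"
    then have i: "i < m * p" and j: "j < n * q" using A B by (auto simp: kronecker_mat_def)
    \<comment> \<open>Here (a, b) is the block containing (i, j), and (e, d) the position within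
      it.\<close>
    define a b d e where "a = i div p" and "b = j div q" and "d = j mod q" and "e = i mod p"
    have abde: "a < m" "b < n" "d < q" "e < p"
      using i j assms by (auto simp: a_def b_def d_def e_def less_mult_imp_div_less)
    have s: "b * m + a < m * n" and t: "d * p + e < p * q"
      using abde mixed_radix_less[of b n a m] mixed_radix_less[of d q e p]
      by (simp_all add: mult.commute)
    have "N $$ (i, j) = N $$ (a * p + e, b * q + d)"
      by (simp add: a_def b_def d_def e_def)
    also have "\<dots> = (y \<otimes>\<^sub>v z) $ ((b * m + a) * (p * q) + (d * p + e))"
      unfolding eq[symmetric] assms(6)
      using assms(5) abde by (rule swap_block_col_stack_index[symmetric])
    \<comment> \<open>Since \<open>d * p + e < p * q\<close>, division by \<open>p * q\<close>
      recovers the index into y and the index into z.\<close>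
    also have "\<dots> = y $ (b * m + a) * z $ (d * p + e)"
      using y z t mixed_radix_less[OF s t] \<open>0 < p\<close> \<open>0 < q\<close> by (simp add: kronecker_vec_def)
    also have "\<dots> = A $$ (a, b) * B $$ (e, d)"
      using abde by (simp add: A_def B_def)
    also have "\<dots> = (A \<otimes>\<^sub>m B) $$ (i, j)"
      unfolding kronecker_mat_index[OF A B i j] by (simp add: a_def b_def d_def e_def)
    finally show "N $$ (i, j) = (A \<otimes>\<^sub>m B) $$ (i, j)" .
  qed (use assms A B in \<open>auto simp: kronecker_mat_def\<close>)
  with A B show "\<exists>A \<in> carrier_mat m n. \<exists>B \<in> carrier_mat p q. N = A \<otimes>\<^sub>m B" by blast
qed

end
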